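(* Consider a row of $n$ seats with two entrances, one at each end, filled by selfish theatregoers who choose seats uniformly at random among the accessible empty seats (model described in the context). Let $F_n$ be the expected number of occupied seats when the process ends. Then $F_n$ is asymptotically $2\ln n$, i.e. $F_n/(2\ln n)\to 1$ as $n\to\infty$.
   Context: Row model: a row consists of $n$ seats numbered $1,\dots,n$ from left to right, with entrances at both ends. Theatregoers arrive one at a time. A selfish theatregoer, once seated, never gets up, so no later theatregoer can walk past her seat. An empty seat is accessible if it can be reached from some entrance without passing a seat occupied by a selfish theatregoer. Each arriving theatregoer sits in an accessible empty seat chosen uniformly at random among all accessible empty seats; the process ends when no accessible empty seat remains. Here all theatregoers are selfish. *)

theory Defs
  imports "HOL-Probability.Probability"
begin

text \<open>
  Seats are the numbers \<open>1, \<dots>, n\<close>; a state of the row is the set \<open>S\<close> of occupied seats.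
  All theatregoers are selfish, so every occupied seat blocks passage.
\<close>

definition reachable_from_left :: "nat set \<Rightarrow> nat \<Rightarrow> bool" where
  "reachable_from_left S s \<longleftrightarrow> (\<forall>t\<in>{1..<s}. t \<notin> S)"

definition reachable_from_right :: "nat \<Rightarrow> nat set \<Rightarrow> nat \<Rightarrow> bool" where
  "reachable_from_right n S s \<longleftrightarrow> (\<forall>t\<in>{s<..n}. t \<notin> S)"

definition accessible :: "nat \<Rightarrow> nat set \<Rightarrow> nat set" where
  "accessible n S =
     {s \<in> {1..n}. s \<notin> S \<and> (reachable_from_left S s \<or> reachable_from_right n S s)}"

lemma finite_accessible: "finite (accessible n S)"
  by (simp add: accessible_def)

text \<open>Distribution of the final set of occupied seats, when the process is started from \<open>S\<close>.\<close>

function final_seating :: "nat \<Rightarrow> nat set \<Rightarrow> nat set pmf" where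
  "final_seating n S =
     (if accessible n S = {} then return_pmf S
      else bind_pmf (pmf_of_set (accessible n S)) (\<lambda>s. final_seating n (insert s S)))"
  by pat_completeness auto

termination
proof (relation "Wellfounded.measure (\<lambda>(n, S). card ({1..n} - S))")
  fix n :: nat and S :: "nat set" and s :: nat
  assume ne: "accessible n S \<noteq> {}" and "s \<in> set_pmf (pmf_of_set (accessible n S))"
  then have "s \<in> accessible n S"
    by (simp add: finite_accessible)
  then have "s \<in> {1..n} - S"
    by (simp add: accessible_def)
  then have "{1..n} - insert s S \<subset> {1..n} - S"
    by blast
  then have "card ({1..n} - insert s S) < card ({1..n} - S)"
    by (intro psubset_card_mono) auto
  then show "((n, insert s S), (n, S)) \<in> Wellfounded.measure (\<lambda>(n, S). card ({1..n} - S))"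
    by simp
qed simp

declare final_seating.simps [simp del]

definition expected_occupied :: "nat \<Rightarrow> real" where
  "expected_occupied n = measure_pmf.expectation (final_seating n {}) (\<lambda>S. real (card S))"

end

theory Submission
  imports Defs
begin

text \<open>
  Once somebody sits, with \<open>a\<close> free seats left of the leftmost and \<open>b\<close> free seats right of the
  rightmost occupied seat, the next person is uniform on these \<open>a + b\<close> seats, and a choice on one
  side leaves the other side untouched. The two sides thus behave like independent one-entrance
  rows, so that \<open>H\<^sub>a + H\<^sub>b\<close> further seats are filled on average. Averaging over the first
  seat gives \<open>F\<^sub>n = 2 H\<^sub>n - 1\<close>.
\<close>

text \<open>This is the recursion \<open>H_n = 1 + (H_0 + ... + H_(n-1)) / n\<close> of a
  one-entrance row with denominators cleared: a uniform choice leaves 0 to \<open>n - 1\<close>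
  seats, equally likely.\<close>

lemma sum_harm_lessThan: "(\<Sum>k<n. harm k) = real n * harm n - real n"
proof (induction n)
  case (Suc n)
  have "real (Suc n) * harm (Suc n) = real (Suc n) * harm n + 1"
    by (simp add: harm_Suc distrib_left del: of_nat_Suc)
  with Suc show ?case
    by (simp add: algebra_simps)
qed simp

lemma sum_harm_pred: "(\<Sum>s\<in>{1..<Suc n}. harm (s - 1)) = real n * harm n - real n"
proof -
  have "(\<Sum>s\<in>{1..<Suc n}. harm (s - 1) :: real) = (\<Sum>k<n. harm k)"
    by (rule sum.reindex_bij_witness[of _ Suc "\<lambda>s. s - 1"]) auto
  then show ?thesis
    by (simp add: sum_harm_lessThan)
qed

lemma sum_harm_diff:
  assumes "r \<le> n"
  shows "(\<Sum>s\<in>{r<..n}. harm (n - s)) = real (n - r) * harm (n - r) - real (n - r)"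
proof -
  have "(\<Sum>s\<in>{r<..n}. harm (n - s) :: real) = (\<Sum>k<n - r. harm k)"
    using assms by (intro sum.reindex_bij_witness[of _ "\<lambda>k. n - k" "\<lambda>s. n - s"]) auto
  then show ?thesis
    by (simp add: sum_harm_lessThan)
qed

text \<open>Finite support lets the expectation of a bind be written as a finite average.\<close>

lemma finite_set_pmf_final_seating: "finite (set_pmf (final_seating n S))"
proof (induction n S rule: final_seating.induct)
  case (1 n S)
  then show ?case
    by (subst final_seating.simps) (auto simp: finite_accessible)
qed

text \<open>Total expectation, conditioning on the seat of the next arrival.\<close>

lemma expectation_final_seating_step:
  assumes "accessible n S \<noteq> {}"
  shows "measure_pmf.expectation (final_seating n S) h =
    (\<Sum>s\<in>accessible n S. measure_pmf.expectation (final_seating n (insert s S)) h)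
      / real (card (accessible n S))"
  using assms
  by (subst final_seating.simps)
    (simp add: pmf_expectation_bind_pmf_of_set finite_accessible finite_set_pmf_final_seating
      divide_inverse sum_distrib_left sum_distrib_right mult.commute)

text \<open>The extreme occupied seats do all the blocking: \<open>l\<close> shuts off everything to
  its right from the left entrance, \<open>r\<close> everything to its left from the right
  one.\<close>

lemma accessible_between:
  assumes "l \<in> S" "r \<in> S" "S \<subseteq> {l..r}" "1 \<le> l" "r \<le> n"
  shows "accessible n S = {1..<l} \<union> {r<..n}"
proof (intro equalityI subsetI)
  fix s
  assume s: "s \<in> accessible n S"
  show "s \<in> {1..<l} \<union> {r<..n}"
  proof (cases "reachable_from_left S s")
    case True
    then have "\<not> l < s" "s \<noteq> l"
      using s assms by (auto simp: accessible_def reachable_from_left_def)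
    then show ?thesis
      using s by (auto simp: accessible_def)
  next
    case False
    then have "\<not> s < r" "s \<noteq> r"
      using s assms by (auto simp: accessible_def reachable_from_right_def)
    then show ?thesis
      using s by (auto simp: accessible_def)
  qed
next
  fix s
  assume s: "s \<in> {1..<l} \<union> {r<..n}"
  have "l \<le> r"
    using assms by auto
  moreover have "l \<le> t \<and> t \<le> r" if "t \<in> S" for t
    using that assms by auto
  ultimately show "s \<in> accessible n S"
    using s assms
    by (fastforce simp: accessible_def reachable_from_left_def reachable_from_right_def)
qed

text \<open>The induction follows the process. The extremes \<open>l\<close> and \<open>r\<close>
  stay arbitrary because each arrival replaces one of them.\<close>

lemma expectation_final_seating:
  assumes "l \<in> S" "r \<in> S" "S \<subseteq> {l..r}" "1 \<le> l" "r \<le> n"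
  shows "measure_pmf.expectation (final_seating n S) (\<lambda>T. real (card T)) =
    real (card S) + harm (l - 1) + harm (n - r)"
  using assms
proof (induction n S arbitrary: l r rule: final_seating.induct)
  case (1 n S)
  let ?E = "\<lambda>S. measure_pmf.expectation (final_seating n S) (\<lambda>T. real (card T))"
  have acc: "accessible n S = {1..<l} \<union> {r<..n}"
    using "1.prems" by (rule accessible_between)
  have lr: "l \<le> r" and fin: "finite S"
    using "1.prems" finite_subset by auto
  show ?case
  proof (cases "accessible n S = {}")
    case True
    then have "l = 1" "n - r = 0"
      using "1.prems" unfolding acc by auto
    then show ?thesis
      using True by (subst final_seating.simps) (simp add: harm_def)
  next
    case False
    define a b where "a = l - 1" and "b = n - r"
    have IH: "?E (insert s S) = real (card (insert s S)) + harm (l' - 1) + harm (n - r')"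
      if "s \<in> accessible n S" "l' \<in> insert s S" "r' \<in> insert s S"
        "insert s S \<subseteq> {l'..r'}" "1 \<le> l'" "r' \<le> n" for s l' r'
      using "1.IH"[OF False _ that(2-)] that(1) False by (simp add: finite_accessible)
    \<comment> \<open>The new extremes are \<open>s\<close> and \<open>r\<close>: the left end
      shrinks to \<open>s - 1\<close> seats, the right end keeps its \<open>b\<close>.\<close>
    have L: "?E (insert s S) = real (card S) + 1 + harm (s - 1) + harm b" if "s \<in> {1..<l}" for s
    proof -
      have "s \<notin> S"
        using that "1.prems" by auto
      then show ?thesis
        using IH[of s s r] that "1.prems" lr fin by (force simp: acc b_def)
    qed
    have R: "?E (insert s S) = real (card S) + 1 + harm a + harm (n - s)" if "s \<in> {r<..n}" for s
    proof -
      have "s \<notin> S"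
        using that "1.prems" by auto
      then show ?thesis
        using IH[of s l s] that "1.prems" lr fin by (force simp: acc a_def)
    qed
    have disj: "{1..<l} \<inter> {r<..n} = {}"
      using lr by auto
    have card: "card (accessible n S) = a + b"
      using card_Un_disjoint[OF _ _ disj] by (simp add: acc a_def b_def)
    then have pos: "real a + real b > 0"
      using False finite_accessible[of n S] by (metis card_gt_0_iff of_nat_0_less_iff of_nat_add)
    have "(\<Sum>s\<in>accessible n S. ?E (insert s S)) =
        (\<Sum>s\<in>{1..<l}. ?E (insert s S)) + (\<Sum>s\<in>{r<..n}. ?E (insert s S))"
      unfolding acc by (rule sum.union_disjoint[OF _ _ disj]) simp_all
    also have "\<dots> = (\<Sum>s\<in>{1..<l}. real (card S) + 1 + harm (s - 1) + harm b) +
        (\<Sum>s\<in>{r<..n}. real (card S) + 1 + harm a + harm (n - s))"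
      using L R by simp
    \<comment> \<open>The harmonic sums contribute \<open>- a\<close> and \<open>- b\<close>, which
      cancel the \<open>+ 1\<close> per summand for the seat just taken.\<close>
    also have "\<dots> = (real a + real b) * (real (card S) + harm a + harm b)"
      using sum_harm_pred[of a] sum_harm_diff[of r n] "1.prems"
      by (simp add: sum.distrib a_def b_def algebra_simps)
    finally show ?thesis
      using pos by (simp add: expectation_final_seating_step[OF False] card a_def b_def)
  qed
qed

text \<open>An empty row has no extreme occupied seats, so the first arrival is averaged separately;
  afterwards its seat \<open>s\<close> serves as both \<open>l\<close> and \<open>r\<close>. At
  \<open>n = 0\<close> the formula would give -1.\<close>

theorem expected_occupied_eq:
  assumes "n \<ge> 1"
  shows "expected_occupied n = 2 * harm n - 1"
proof -
  have acc: "accessible n {} = {0<..n}"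
    by (auto simp: accessible_def reachable_from_left_def)
  have "expected_occupied n = (\<Sum>s\<in>{0<..n}. 1 + harm (s - 1) + harm (n - s)) / real n"
    unfolding expected_occupied_def using assms
    by (subst expectation_final_seating_step)
      (auto simp: acc intro!: sum.cong expectation_final_seating[THEN trans])
  also have "(\<Sum>s\<in>{0<..n}. 1 + harm (s - 1) + harm (n - s)) = real n * (2 * harm n - 1)"
  proof -
    have "{0<..n} = {1..<Suc n}"
      by auto
    then show ?thesis
      using sum_harm_pred[of n] sum_harm_diff[of 0 n]
      by (simp add: sum.distrib algebra_simps)
  qed
  finally show ?thesis
    using assms by simp
qed

theorem theorem2: "(\<lambda>n. expected_occupied n / (2 * ln (real n))) \<longlonglongrightarrow> 1"
proof -
  have ln: "filterlim (\<lambda>n. ln (real n)) at_top sequentially"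
    by (rule filterlim_compose[OF ln_at_top filterlim_real_sequentially])
  \<comment> \<open>The numerator converges, to the Euler-Mascheroni constant minus 1/2; the 1/2 is
    half of the 1 in \<open>2 * harm n - 1\<close>.\<close>
  have "(\<lambda>n. (harm n - ln (real n) - 1 / 2) / ln (real n)) \<longlonglongrightarrow> 0"
    by (rule real_tendsto_divide_at_top[OF tendsto_diff[OF euler_mascheroni_LIMSEQ tendsto_const] ln])
  from tendsto_add[OF tendsto_const[of 1] this]
  have "(\<lambda>n. 1 + (harm n - ln (real n) - 1 / 2) / ln (real n)) \<longlonglongrightarrow> 1"
    by simp
  moreover have "\<forall>\<^sub>F n in sequentially.
      1 + (harm n - ln (real n) - 1 / 2) / ln (real n) = expected_occupied n / (2 * ln (real n))"
    \<comment> \<open>From 2 on the logarithm is nonzero and can be cancelled.\<close>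
    using eventually_ge_at_top[of 2]
  proof eventually_elim
    case (elim n)
    then have "ln (real n) > 0"
      by simp
    then show ?case
      using elim by (simp add: expected_occupied_eq field_simps)
  qed
  ultimately show ?thesis
    by (rule Lim_transform_eventually)
qed

end
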